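(* Let $G$ be a finite non-abelian group such that $G/Z(G) \cong \mathbb{Z}_p \times \mathbb{Z}_p$ for a prime $p$. Then the commuting conjugacy class graph $\Gamma_G$ of $G$ is neither CNL-hyperenergetic nor CNSL-hyperenergetic.
   Context: For a finite non-abelian group $G$ with center $Z(G)$, the commuting conjugacy class graph (CCC-graph) $\Gamma_G$ is the simple undirected graph whose vertices are the conjugacy classes $x^G$ of non-central elements $x \in G \setminus Z(G)$; two distinct vertices $x^G, y^G$ are adjacent if there exist $x' \in x^G$ and $y' \in y^G$ with $x'y' = y'x'$. For a finite simple graph $\mathcal{G}$ with vertices $v_1,\dots,v_N$, let $CN(\mathcal{G})$ be the $N\times N$ matrix whose $(i,j)$ entry is, for $i\ne j$, the number of vertices other than $v_i,v_j$ adjacent to both $v_i$ and $v_j$, and whose diagonal entries are $0$. Let $CNRS(\mathcal{G})$ be the diagonal matrix whose $i$-th diagonal entry is the $i$-th row sum of $CN(\mathcal{G})$. Put $CNL(\mathcal{G}) = CNRS(\mathcal{G}) - CN(\mathcal{G})$, $CNSL(\mathcal{G}) = CNRS(\mathcal{G}) + CN(\mathcal{G})$ and $\Delta(\mathcal{G}) = \operatorname{tr}(CNRS(\mathcal{G}))/N$. Then $LE_{CN}(\mathcal{G}) = \sum_{\alpha} |\alpha - \Delta(\mathcal{G})|$ over all eigenvalues $\alpha$ of $CNL(\mathcal{G})$ with multiplicity, and $LE^+_{CN}(\mathcal{G}) = \sum_{\beta} |\beta - \Delta(\mathcal{G})|$ over all eigenvalues $\beta$ of $CNSL(\mathcal{G})$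 with multiplicity. A graph $\mathcal{G}$ of order $N$ is CNL-hyperenergetic if $LE_{CN}(\mathcal{G}) > 2(N-1)(N-2)$ and CNSL-hyperenergetic if $LE^+_{CN}(\mathcal{G}) > 2(N-1)(N-2)$. *)

theory Defs
  imports
    "HOL-Algebra.Group_Action"
    "HOL-Algebra.Elementary_Groups"
    "HOL-Computational_Algebra.Primes"
    "HOL-Computational_Algebra.Fundamental_Theorem_Algebra"
    "Jordan_Normal_Form.Char_Poly"
    "Graph_Theory.Pair_Digraph"
begin

definition center :: "('a, 'b) monoid_scheme \<Rightarrow> 'a set" where
  "center G = {z \<in> carrier G. \<forall>x \<in> carrier G. z \<otimes>\<^bsub>G\<^esub> x = x \<otimes>\<^bsub>G\<^esub> z}"

text \<open>The group action is the one of \<open>group.action_by_conjugation\<close>.\<close>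

definition conj_class :: "('a, 'b) monoid_scheme \<Rightarrow> 'a \<Rightarrow> 'a set" where
  "conj_class G x =
     orbit G (\<lambda>g. \<lambda>h \<in> carrier G. g \<otimes>\<^bsub>G\<^esub> h \<otimes>\<^bsub>G\<^esub> inv\<^bsub>G\<^esub> g) x"

text \<open>
  Simple undirected graphs are represented as in the locale \<open>pair_graph\<close>: a finite vertex set
  together with a symmetric irreflexive set of arcs.
\<close>

definition CCC_graph :: "('a, 'b) monoid_scheme \<Rightarrow> 'a set pair_pre_digraph" where
  "CCC_graph G =
     (let V = {conj_class G x | x. x \<in> carrier G - center G} in
      \<lparr> pverts = V,
        parcs = {(A, B). A \<in> V \<and> B \<in> V \<and> A \<noteq> B \<and>
                   (\<exists>x' \<in> A. \<exists>y' \<in> B. x' \<otimes>\<^bsub>G\<^esub> y' = y' \<otimes>\<^bsub>G\<^esub> x')} \<rparr>)"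

definition common_nbrs :: "'v pair_pre_digraph \<Rightarrow> 'v \<Rightarrow> 'v \<Rightarrow> 'v set" where
  "common_nbrs \<G> u v =
     {w \<in> pverts \<G>. w \<noteq> u \<and> w \<noteq> v \<and> (u, w) \<in> parcs \<G> \<and> (v, w) \<in> parcs \<G>}"

text \<open>
  The matrices below depend on an enumeration \<open>vs\<close> of the vertices, with matrix indices
  starting at 0.
\<close>

definition CN :: "'v pair_pre_digraph \<Rightarrow> 'v list \<Rightarrow> real mat" where
  "CN \<G> vs = mat (length vs) (length vs)
     (\<lambda>(i, j). if i = j then 0 else real (card (common_nbrs \<G> (vs ! i) (vs ! j))))"

definition CNRS :: "'v pair_pre_digraph \<Rightarrow> 'v list \<Rightarrow> real mat" where
  "CNRS \<G> vs = mat_diag (length vs) (\<lambda>i. \<Sum>j<length vs. CN \<G> vs $$ (i, j))"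

definition CNL :: "'v pair_pre_digraph \<Rightarrow> 'v list \<Rightarrow> real mat" where
  "CNL \<G> vs = CNRS \<G> vs - CN \<G> vs"

definition CNSL :: "'v pair_pre_digraph \<Rightarrow> 'v list \<Rightarrow> real mat" where
  "CNSL \<G> vs = CNRS \<G> vs + CN \<G> vs"

definition CN_mean :: "'v pair_pre_digraph \<Rightarrow> 'v list \<Rightarrow> real" where
  "CN_mean \<G> vs = sum_list (diag_mat (CNRS \<G> vs)) / real (length vs)"

text \<open>
  Eigenvalues are taken over the complex numbers, so that an \<open>n \<times> n\<close> matrix has exactly \<open>n\<close>
  of them, counted with multiplicity, without appeal to the spectral theorem.
\<close>

definition eigvals_mset :: "real mat \<Rightarrow> complex multiset" where
  "eigvals_mset A = proots (char_poly (map_mat complex_of_real A))"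

definition energy_about :: "real \<Rightarrow> real mat \<Rightarrow> real" where
  "energy_about d A = (\<Sum>\<alpha>\<in>#eigvals_mset A. cmod (\<alpha> - complex_of_real d))"

text \<open>
  The energies do not depend on the enumeration chosen here; see \<open>LE_CN_eq\<close> and
  \<open>LE_CN_plus_eq\<close> below.
\<close>

definition vertex_enum :: "'v pair_pre_digraph \<Rightarrow> 'v list" where
  "vertex_enum \<G> = (SOME vs. distinct vs \<and> set vs = pverts \<G>)"

definition LE_CN :: "'v pair_pre_digraph \<Rightarrow> real" where
  "LE_CN \<G> = (let vs = vertex_enum \<G> in energy_about (CN_mean \<G> vs) (CNL \<G> vs))"

definition LE_CN_plus :: "'v pair_pre_digraph \<Rightarrow> real" where
  "LE_CN_plus \<G> = (let vs = vertex_enum \<G> in energy_about (CN_mean \<G> vs) (CNSL \<G> vs))"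

definition CNL_hyperenergetic :: "'v pair_pre_digraph \<Rightarrow> bool" where
  "CNL_hyperenergetic \<G> \<longleftrightarrow>
     LE_CN \<G> > 2 * (real (card (pverts \<G>)) - 1) * (real (card (pverts \<G>)) - 2)"

definition CNSL_hyperenergetic :: "'v pair_pre_digraph \<Rightarrow> bool" where
  "CNSL_hyperenergetic \<G> \<longleftrightarrow>
     LE_CN_plus \<G> > 2 * (real (card (pverts \<G>)) - 1) * (real (card (pverts \<G>)) - 2)"


lemma (in group) center_normal: "center G \<lhd> G"
proof (rule normal_invI)
  show "subgroup (center G) G"
  proof (rule subgroupI)
    show "center G \<subseteq> carrier G" by (auto simp: center_def)
    have "\<one> \<in> center G" by (simp add: center_def)
    then show "center G \<noteq> {}" by blast
  next
    fix a assume a: "a \<in> center G"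
    then have ac: "a \<in> carrier G" by (simp add: center_def)
    have "inv a \<otimes> x = x \<otimes> inv a" if x: "x \<in> carrier G" for x
    proof -
      have ax: "a \<otimes> x = x \<otimes> a" using a x by (simp add: center_def)
      have "inv a \<otimes> x = inv a \<otimes> (x \<otimes> a) \<otimes> inv a" using ac x by (simp add: m_assoc)
      also have "\<dots> = inv a \<otimes> (a \<otimes> x) \<otimes> inv a" by (simp only: ax)
      also have "\<dots> = x \<otimes> inv a" using ac x by (simp add: m_assoc[symmetric])
      finally show ?thesis .
    qed
    then show "inv a \<in> center G" using ac by (simp add: center_def)
  next
    fix a b assume ab: "a \<in> center G" "b \<in> center G"
    then have c: "a \<in> carrier G" "b \<in> carrier G" by (auto simp: center_def)
    have "a \<otimes> b \<otimes> x = x \<otimes> (a \<otimes> b)" if x: "x \<in> carrier G" for x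
    proof -
      have "a \<otimes> b \<otimes> x = a \<otimes> (b \<otimes> x)" using c x by (simp add: m_assoc)
      also have "\<dots> = a \<otimes> (x \<otimes> b)" using ab x by (simp add: center_def)
      also have "\<dots> = a \<otimes> x \<otimes> b" using c x by (simp add: m_assoc)
      also have "\<dots> = x \<otimes> a \<otimes> b" using ab x by (simp add: center_def)
      finally show ?thesis using c x by (simp add: m_assoc)
    qed
    then show "a \<otimes> b \<in> center G" using c by (simp add: center_def)
  qed
next
  fix x h assume x: "x \<in> carrier G" and h: "h \<in> center G"
  then have hc: "h \<in> carrier G" and eq: "x \<otimes> h = h \<otimes> x" by (auto simp: center_def)
  have "x \<otimes> h \<otimes> inv x = h \<otimes> x \<otimes> inv x" by (simp only: eq)
  also have "\<dots> = h" using x hc by (simp add: m_assoc)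
  finally show "x \<otimes> h \<otimes> inv x \<in> center G" using h by simp
qed

lemma (in group) pair_graph_CCC_graph:
  assumes "finite (carrier G)"
  shows "pair_graph (CCC_graph G)"
proof -
  let ?V = "{conj_class G x | x. x \<in> carrier G - center G}"
  have fin: "finite ?V" using assms by simp
  have sub: "parcs (CCC_graph G) \<subseteq> ?V \<times> ?V"
    unfolding CCC_graph_def Let_def by auto
  have "finite (parcs (CCC_graph G))"
    by (rule finite_subset[OF sub finite_cartesian_product[OF fin fin]])
  moreover have "symmetric (with_proj (CCC_graph G))"
    unfolding symmetric_def with_proj_simps
  proof (rule symI)
    fix A B assume "(A, B) \<in> parcs (CCC_graph G)"
    then have AB: "A \<in> ?V" "B \<in> ?V" "A \<noteq> B"
      and "\<exists>x' \<in> A. \<exists>y' \<in> B. x' \<otimes> y' = y' \<otimes> x'"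
      unfolding CCC_graph_def Let_def by simp_all
    then obtain x' y' where "x' \<in> A" "y' \<in> B" "x' \<otimes> y' = y' \<otimes> x'" by blast
    then have "\<exists>x' \<in> B. \<exists>y' \<in> A. x' \<otimes> y' = y' \<otimes> x'" by metis
    with AB show "(B, A) \<in> parcs (CCC_graph G)"
      unfolding CCC_graph_def Let_def by simp
  qed
  moreover have "finite (pverts (CCC_graph G))"
    using fin by (simp add: CCC_graph_def Let_def)
  moreover have "fst e \<in> pverts (CCC_graph G)" "snd e \<in> pverts (CCC_graph G)" "fst e \<noteq> snd e"
    if "e \<in> parcs (CCC_graph G)" for e
    using that by (cases e; simp add: CCC_graph_def Let_def)+
  ultimately show ?thesis
    by unfold_locales
qed

lemma char_poly_reindex:
  fixes A :: "'a :: idom mat"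
  assumes A: "A \<in> carrier_mat n n" and p: "p permutes {0..<n}"
  shows "char_poly (mat n n (\<lambda>(i, j). A $$ (p i, p j))) = char_poly A"
proof -
  define B where "B = char_poly_matrix A"
  have B: "B \<in> carrier_mat n n" using A by (simp add: B_def)
  have pn: "p i < n" if "i < n" for i using that permutes_in_image[OF p, of i] by auto
  have pe: "p i = p j \<longleftrightarrow> i = j" for i j using permutes_inj[OF p] by (auto dest: injD)
  define C where "C = mat n n (\<lambda>(i, j). B\<^sup>T $$ (p i, j))"
  have C: "C \<in> carrier_mat n n" by (simp add: C_def)
  have detC: "det C = signof p * det B"
    unfolding C_def using det_permute_rows[OF _ p, of "B\<^sup>T"] B by (simp add: det_transpose)
  have "char_poly_matrix (mat n n (\<lambda>(i, j). A $$ (p i, p j))) =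
          mat n n (\<lambda>(i, j). C\<^sup>T $$ (p i, j))"
    using A B pn pe
    by (intro eq_matI) (auto simp: char_poly_matrix_def B_def C_def)
  also have "det \<dots> = signof p * det (C\<^sup>T)"
    by (rule det_permute_rows[OF _ p]) (use C in simp)
  also have "det (C\<^sup>T) = signof p * det B"
    using det_transpose[OF C] detC by simp
  also have "signof p * (signof p * det B) = det B" by (simp add: sign_def)
  finally show ?thesis by (simp add: char_poly_def B_def)
qed

context
  fixes \<G> :: "'v pair_pre_digraph" and vs ws :: "'v list"
  assumes vs: "distinct vs" and ws: "distinct ws" and same: "set vs = set ws"
begin

lemma enum_perm:
  obtains p where "p permutes {0..<length vs}" "length ws = length vs"
    "\<And>i. i < length vs \<Longrightarrow> ws ! i = vs ! p i"
proof -
  have m: "mset ws = mset vs" using vs ws same by (simp add: set_eq_iff_mset_eq_distinct)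
  then obtain p where p: "p permutes {..<length vs}" "permute_list p vs = ws"
    using mset_eq_permutation by metis
  then show ?thesis
    by (intro that[of p]) (auto simp: atLeast0LessThan permute_list_nth)
qed

lemma enum_invariant:
  "CN_mean \<G> vs = CN_mean \<G> ws"
  "char_poly (map_mat complex_of_real (CNL \<G> vs)) = char_poly (map_mat complex_of_real (CNL \<G> ws))"
  "char_poly (map_mat complex_of_real (CNSL \<G> vs)) = char_poly (map_mat complex_of_real (CNSL \<G> ws))"
proof -
  define n where "n = length vs"
  obtain p where p: "p permutes {0..<n}" and len: "length ws = n"
    and nth: "\<And>i. i < n \<Longrightarrow> ws ! i = vs ! p i"
    using enum_perm unfolding n_def by blast
  have pn: "p i < n" if "i < n" for i using that permutes_in_image[OF p, of i] by auto
  have pe: "p i = p j \<longleftrightarrow> i = j" for i j using permutes_inj[OF p] by (auto dest: injD)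
  have CN: "CN \<G> ws $$ (i, j) = CN \<G> vs $$ (p i, p j)" if "i < n" "j < n" for i j
    using that pn pe nth len by (auto simp: CN_def n_def)
  define r where "r i = (\<Sum>j<n. CN \<G> vs $$ (i, j))" for i
  have r: "(\<Sum>j<n. CN \<G> ws $$ (i, j)) = r (p i)" if i: "i < n" for i
  proof -
    have "(\<Sum>j<n. CN \<G> ws $$ (i, j)) = (\<Sum>j<n. CN \<G> vs $$ (p i, p j))"
      using CN i by simp
    also have "\<dots> = (\<Sum>j<n. CN \<G> vs $$ (p i, j))"
      using sum.permute[of p "{..<n}" "\<lambda>j. CN \<G> vs $$ (p i, j)"] p
      by (simp add: atLeast0LessThan o_def)
    finally show ?thesis by (simp add: r_def)
  qed
  have R: "CNRS \<G> vs = mat_diag n r" by (simp add: CNRS_def n_def r_def[abs_def])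
  have R': "CNRS \<G> ws = mat_diag n (r \<circ> p)"
    using r len by (intro eq_matI) (auto simp: CNRS_def mat_diag_def)
  have tr: "sum_list (diag_mat (mat_diag n f)) = sum f {0..<n}" for f :: "nat \<Rightarrow> real"
    by (simp add: diag_mat_def mat_diag_def interv_sum_list_conv_sum_set_nat)
  show "CN_mean \<G> vs = CN_mean \<G> ws"
    unfolding CN_mean_def R R' tr len n_def[symmetric] using sum.permute[OF p, of r] by simp
  have dims: "CN \<G> vs \<in> carrier_mat n n" "CN \<G> ws \<in> carrier_mat n n"
    by (simp_all add: CN_def len n_def)
  have L: "CNL \<G> vs \<in> carrier_mat n n" and S: "CNSL \<G> vs \<in> carrier_mat n n"
    using dims unfolding CNL_def CNSL_def R by auto
  have L': "map_mat complex_of_real (CNL \<G> ws) =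
      mat n n (\<lambda>(i, j). map_mat complex_of_real (CNL \<G> vs) $$ (p i, p j))"
    unfolding CNL_def R R' using dims CN pn pe
    by (intro eq_matI) (auto simp: mat_diag_def)
  have S': "map_mat complex_of_real (CNSL \<G> ws) =
      mat n n (\<lambda>(i, j). map_mat complex_of_real (CNSL \<G> vs) $$ (p i, p j))"
    unfolding CNSL_def R R' using dims CN pn pe
    by (intro eq_matI) (auto simp: mat_diag_def)
  show "char_poly (map_mat complex_of_real (CNL \<G> vs)) =
      char_poly (map_mat complex_of_real (CNL \<G> ws))"
    unfolding L' by (rule char_poly_reindex[symmetric, OF _ p]) (use L in simp)
  show "char_poly (map_mat complex_of_real (CNSL \<G> vs)) =
      char_poly (map_mat complex_of_real (CNSL \<G> ws))"
    unfolding S' by (rule char_poly_reindex[symmetric, OF _ p]) (use S in simp)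
qed

end

lemma vertex_enum:
  assumes "finite (pverts \<G>)"
  shows "distinct (vertex_enum \<G>)" "set (vertex_enum \<G>) = pverts \<G>"
  using someI_ex[of "\<lambda>vs. distinct vs \<and> set vs = pverts \<G>"] finite_distinct_list[OF assms]
  unfolding vertex_enum_def by blast+

lemma
  assumes "distinct vs" and "set vs = pverts \<G>"
  shows LE_CN_eq: "LE_CN \<G> = energy_about (CN_mean \<G> vs) (CNL \<G> vs)"
    and LE_CN_plus_eq: "LE_CN_plus \<G> = energy_about (CN_mean \<G> vs) (CNSL \<G> vs)"
proof -
  have fin: "finite (pverts \<G>)" using assms by (metis List.finite_set)
  have s: "set (vertex_enum \<G>) = set vs" using vertex_enum(2)[OF fin] assms(2) by simp
  note inv = enum_invariant[OF vertex_enum(1)[OF fin] assms(1) s]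
  show "LE_CN \<G> = energy_about (CN_mean \<G> vs) (CNL \<G> vs)"
    and "LE_CN_plus \<G> = energy_about (CN_mean \<G> vs) (CNSL \<G> vs)"
    by (simp_all add: LE_CN_def LE_CN_plus_def Let_def energy_about_def eigvals_mset_def inv)
qed

end

theory Submission
  imports Defs "Jordan_Normal_Form.Schur_Decomposition"
begin

text \<open>
  Modulo the center, \<open>G\<close> is abelian of order \<open>p\<^sup>2\<close>. By Lagrange the centralizer of every noncentral
  element has order \<open>p |Z(G)|\<close>, and so has the intersection of two such centralizers when the
  elements commute; hence noncentral elements commute iff their centralizers coincide. A conjugate
  of \<open>x\<close> lies in \<open>Z(G) x\<close>, so the centralizer only depends on the class, and every noncentral class
  has \<open>p\<close> elements. Thus the graph is a disjoint union of complete graphs of the same order \<open>n\<close>.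

  For any such union with \<open>N\<close> vertices, the matrix \<open>CN\<close> has constant row sums, so both energies are
  sums of absolute values of eigenvalues of \<open>CN\<close>, and come out as \<open>2 N (n - 1)(n - 2) / n\<close>, which is
  at most \<open>2 (N - 1)(N - 2)\<close> because \<open>n \<le> N\<close>.
\<close>

section \<open>Traces and eigenvalues\<close>

text \<open>Since \<open>X * Y\<close> and \<open>Y * X\<close> have the same trace, the trace of
  \<open>P * B * Q\<close> is that of \<open>Q * (P * B)\<close>, which is \<open>B\<close>.\<close>

lemma sum_diag_similar:
  fixes A :: "'a::comm_ring_1 mat"
  assumes A: "A \<in> carrier_mat n n" and sim: "similar_mat_wit A B P Q"
  shows "sum_list (diag_mat A) = sum_list (diag_mat B)"
proof -
  note D = similar_mat_witD2[OF A sim]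
  have carr: "P * B \<in> carrier_mat n n" using D by auto
  have tr: "sum_list (diag_mat (X * Y)) = (\<Sum>i<n. \<Sum>j<n. X $$ (i, j) * Y $$ (j, i))"
    if "X \<in> carrier_mat n n" "Y \<in> carrier_mat n n" for X Y :: "'a mat"
    using that by (simp add: diag_mat_def interv_sum_list_conv_sum_set_nat scalar_prod_def
        atLeast0LessThan)
  have swap: "sum_list (diag_mat (X * Y)) = sum_list (diag_mat (Y * X))"
    if "X \<in> carrier_mat n n" "Y \<in> carrier_mat n n" for X Y :: "'a mat"
    unfolding tr[OF that] tr[OF that(2,1)] by (subst sum.swap) (simp add: mult.commute)
  have "Q * (P * B) = B"
    using D assoc_mult_mat[of Q n n P n B n] by simp
  then show ?thesis
    unfolding D(3) swap[OF carr D(7)] by simp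
qed

text \<open>Over the complex numbers the characteristic polynomial splits. Schur decomposition then
  gives a similar matrix whose diagonal lists its roots with multiplicity, and similarity preserves
  the trace.\<close>

lemma sum_eigvals:
  fixes A :: "real mat"
  assumes A: "A \<in> carrier_mat n n"
  shows "\<Sum>\<^sub># (eigvals_mset A) = complex_of_real (sum_list (diag_mat A))"
    and "size (eigvals_mset A) = n"
proof -
  let ?A = "map_mat complex_of_real A"
  have cA: "?A \<in> carrier_mat n n" using A by simp
  obtain es where es: "char_poly ?A = (\<Prod>e\<leftarrow>es. [:- e, 1:])" "length es = n"
    using char_poly_factorized[OF cA] by blast
  obtain B P Q where "schur_decomposition ?A es = (B, P, Q)" by (cases "schur_decomposition ?A es")
  from schur_decomposition[OF cA es(1) this]
  have B: "similar_mat_wit ?A B P Q" "diag_mat B = es" by auto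
  have roots: "proots (\<Prod>e\<leftarrow>xs. [:- e, 1:]) = mset xs" for xs :: "complex list"
  proof (induction xs)
    case (Cons a xs)
    have "(\<Prod>e\<leftarrow>xs. [:- e, 1:]) \<noteq> 0" by (auto simp: prod_list_zero_iff)
    then show ?case using Cons by (simp add: proots_mult del: mult_pCons_left)
  qed simp
  have ev: "eigvals_mset A = mset es" by (simp add: eigvals_mset_def es(1) roots)
  have "\<Sum>\<^sub># (eigvals_mset A) = sum_list (diag_mat ?A)"
    using sum_diag_similar[OF cA B(1)] B(2) by (simp add: ev sum_mset_sum_list)
  also have "\<dots> = complex_of_real (sum_list (diag_mat A))"
    using A by (simp add: diag_mat_def interv_sum_list_conv_sum_set_nat)
  finally show "\<Sum>\<^sub># (eigvals_mset A) = complex_of_real (sum_list (diag_mat A))" .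
  show "size (eigvals_mset A) = n" using es(2) by (simp add: ev)
qed

section \<open>Spectrum and energy of equal blocks\<close>

text \<open>On each fibre of \<open>f\<close> the matrix is \<open>s (J - I)\<close>, with
  \<open>J\<close> the all-ones matrix. Adding \<open>s * w i\<close> to the eigenvalue equation
  turns its left side into \<open>s\<close> times the fibre sum \<open>S i\<close>. If
  \<open>\<mu> + s\<close> is nonzero, some \<open>S i\<close> is nonzero, and summing over that
  fibre gives \<open>(\<mu> + s) * S i = n * s * S i\<close>.\<close>

lemma clique_eigenvalue:
  fixes f :: "nat \<Rightarrow> 'c" and w :: "nat \<Rightarrow> complex"
  assumes cl: "\<And>i. i < N \<Longrightarrow> card {j \<in> {..<N}. f j = f i} = n"
    and ev: "\<And>i. i < N \<Longrightarrow> (\<Sum>j<N. (if i \<noteq> j \<and> f j = f i then s else 0) * w j) = \<mu> * w i"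
    and nz: "\<exists>i<N. w i \<noteq> 0"
  shows "\<mu> = - s \<or> \<mu> = (of_nat n - 1) * s"
proof (cases "\<mu> = - s")
  case False
  define S where "S i = (\<Sum>j | j < N \<and> f j = f i. w j)" for i
  have S: "(\<mu> + s) * w i = s * S i" if i: "i < N" for i
  proof -
    have "(\<Sum>j<N. (if i \<noteq> j \<and> f j = f i then s else 0) * w j)
        = (\<Sum>j<N. (if f j = f i then s * w j else 0) - (if j = i then s * w i else 0))"
      by (rule sum.cong) auto
    also have "\<dots> = (\<Sum>j<N. if f j = f i then s * w j else 0) - s * w i"
      using i by (simp add: sum_subtractf)
    also have "(\<Sum>j<N. if f j = f i then s * w j else 0) = s * S i"
      unfolding S_def sum_distrib_left by (rule sum.mono_neutral_cong_right) auto
    finally show ?thesis using ev[OF i] by (simp add: algebra_simps)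
  qed
  obtain i where i: "i < N" "w i \<noteq> 0" using nz by blast
  have "(\<mu> + s) * w i \<noteq> 0" using i(2) False by (simp add: add_eq_0_iff2)
  then have Si: "S i \<noteq> 0" using S[OF i(1)] by auto
  have "(\<mu> + s) * S i = (\<Sum>j | j < N \<and> f j = f i. (\<mu> + s) * w j)"
    by (simp add: S_def sum_distrib_left)
  also have "\<dots> = (\<Sum>j | j < N \<and> f j = f i. s * S i)"
    by (rule sum.cong) (auto simp: S, simp add: S_def)
  also have "\<dots> = of_nat n * s * S i"
    using cl[OF i(1)] by simp
  finally have "\<mu> + s = of_nat n * s" using Si by simp
  then show ?thesis by (simp add: algebra_simps)
qed simp

lemma of_real_sum_mset:
  "of_real (\<Sum>x\<in>#M. h x) = (\<Sum>x\<in>#M. of_real (h x))"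
  by (induction M) simp_all

lemma sum_mset_affine:
  fixes a b c :: "'a::comm_ring_1"
  shows "(\<Sum>x\<in>#M. a * (x - b) + c) = a * (\<Sum>\<^sub># M - of_nat (size M) * b) + of_nat (size M) * c"
  by (induction M) (simp_all add: algebra_simps)

text \<open>
  On the two possible eigenvalues \<open>- s\<close> and \<open>(n - 1) s\<close> of the off-diagonal part, the absolute value
  agrees with an affine function. As that part has trace \<open>0\<close>, the multiplicities are not needed.
\<close>

lemma clique_energy:
  fixes f :: "nat \<Rightarrow> 'c" and A :: "real mat"
  assumes A: "A \<in> carrier_mat N N"
    and ent: "\<And>i j. i < N \<Longrightarrow> j < N \<Longrightarrow>
      A $$ (i, j) = (if i = j then r else if f j = f i then \<sigma> * s else 0)"
    and cl: "\<And>i. i < N \<Longrightarrow> card {j \<in> {..<N}. f j = f i} = n"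
    and n: "n > 0" and s: "s \<ge> 0" and \<sigma>: "\<sigma> = 1 \<or> \<sigma> = -1"
  shows "energy_about r A = 2 * real N * s * (real n - 1) / real n"
proof -
  \<comment> \<open>The line \<open>c * x + d\<close> is the one through the points
    \<open>(- s, s)\<close> and \<open>((n - 1) s, (n - 1) s)\<close> of the graph of the absolute
    value.\<close>
  define c where "c = (real n - 2) / real n"
  define d where "d = s * (2 * real n - 2) / real n"
  have eig: "complex_of_real (cmod (\<alpha> - of_real r)) = of_real (c * \<sigma>) * (\<alpha> - of_real r) + of_real d"
    if "\<alpha> \<in># eigvals_mset A" for \<alpha>
  proof -
    let ?A = "map_mat complex_of_real A"
    have cA: "?A \<in> carrier_mat N N" using A by simp
    have "char_poly ?A \<noteq> 0" using degree_monic_char_poly[OF cA] by auto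
    then have "poly (char_poly ?A) \<alpha> = 0" using that by (simp add: eigvals_mset_def)
    then obtain v where v: "v \<in> carrier_vec N" "v \<noteq> 0\<^sub>v N" "?A *\<^sub>v v = \<alpha> \<cdot>\<^sub>v v"
      using eigenvalue_root_char_poly[OF cA] A by (auto simp: eigenvalue_def eigenvector_def)
    \<comment> \<open>Here \<open>A = r I + \<sigma> M\<close> with \<open>M\<close> the unsigned
      off-diagonal part. As \<open>\<sigma>\<close> squares to 1, \<open>v\<close> is an eigenvector
      of \<open>M\<close> for the value \<open>?\<mu>\<close>.\<close>
    let ?\<mu> = "of_real \<sigma> * (\<alpha> - of_real r)"
    have \<sigma>2: "complex_of_real \<sigma> * (complex_of_real \<sigma> * z) = z" for z
      using \<sigma> by auto
    have "?\<mu> = - of_real s \<or> ?\<mu> = (of_nat n - 1) * of_real s"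
    proof (rule clique_eigenvalue[OF cl, where w = "\<lambda>i. v $ i"])
      show "\<exists>i<N. v $ i \<noteq> 0" using v(1,2) by (auto intro!: eq_vecI)
    next
      fix i assume i: "i < N"
      have "(\<Sum>j<N. complex_of_real (A $$ (i, j)) * v $ j) = (?A *\<^sub>v v) $ i"
        using A v(1) i by (simp add: scalar_prod_def atLeast0LessThan)
      also have "\<dots> = \<alpha> * v $ i" using v(1,3) i by simp
      also have "(\<Sum>j<N. complex_of_real (A $$ (i, j)) * v $ j) =
          (\<Sum>j<N. of_real \<sigma> * ((if i \<noteq> j \<and> f j = f i then of_real s else 0) * v $ j)
             + (if j = i then of_real r * v $ i else 0))"
        using i by (intro sum.cong) (auto simp: ent)
      also have "\<dots> = of_real \<sigma> * (\<Sum>j<N. (if i \<noteq> j \<and> f j = f i then of_real s else 0) * v $ j)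
          + of_real r * v $ i"
        using i by (simp add: sum.distrib sum_distrib_left)
      finally have "of_real \<sigma> * (\<Sum>j<N. (if i \<noteq> j \<and> f j = f i then of_real s else 0) * v $ j)
          = (\<alpha> - of_real r) * v $ i" by (simp add: algebra_simps)
      from arg_cong[OF this, of "\<lambda>z. of_real \<sigma> * z"]
      show "(\<Sum>j<N. (if i \<noteq> j \<and> f j = f i then of_real s else 0) * v $ j) = ?\<mu> * v $ i"
        by (simp only: \<sigma>2 mult.assoc)
    qed
    then have "?\<mu> = of_real (- s) \<or> ?\<mu> = of_real ((real n - 1) * s)" by simp
    then obtain x where x: "?\<mu> = complex_of_real x" "x = - s \<or> x = (real n - 1) * s"
      by blast
    have "c * real n = real n - 2" "d * real n = s * (2 * real n - 2)"
      using n by (simp_all add: c_def d_def)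
    then have cd: "(c * x + d) * real n = x * (real n - 2) + s * (2 * real n - 2)"
      by (metis (no_types, opaque_lifting) distrib_right mult.assoc mult.commute)
    have abs: "\<bar>x\<bar> = c * x + d"
      using x(2)
    proof
      assume "x = - s"
      then have "\<bar>x\<bar> * real n = (c * x + d) * real n"
        unfolding cd using s by (simp add: algebra_simps)
      then show ?thesis using n by simp
    next
      assume x: "x = (real n - 1) * s"
      have "x \<ge> 0" unfolding x using n s by simp
      then have "\<bar>x\<bar> = x" by simp
      then have "\<bar>x\<bar> * real n = (c * x + d) * real n"
        unfolding cd by (simp add: x algebra_simps)
      then show ?thesis using n by simp
    qed
    \<comment> \<open>The sign \<open>\<sigma>\<close> drops out of the modulus, and it cancels
      against the factor \<open>\<sigma>\<close> in the affine expression.\<close>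
    have al: "\<alpha> - of_real r = of_real (\<sigma> * x)" using x(1) \<sigma>2[of "\<alpha> - of_real r"] by simp
    have "cmod (\<alpha> - of_real r) = \<bar>x\<bar>" unfolding al norm_of_real using \<sigma> by auto
    then show ?thesis unfolding al abs using \<sigma> by auto
  qed
  have diag: "sum_list (diag_mat A) = real N * r"
    using A ent by (simp add: diag_mat_def interv_sum_list_conv_sum_set_nat)
  have "complex_of_real (energy_about r A) =
      (\<Sum>\<alpha>\<in>#eigvals_mset A. complex_of_real (cmod (\<alpha> - of_real r)))"
    unfolding energy_about_def by (rule of_real_sum_mset)
  also have "\<dots> = (\<Sum>\<alpha>\<in>#eigvals_mset A. of_real (c * \<sigma>) * (\<alpha> - of_real r) + of_real d)"
    using eig by (intro arg_cong[where f = sum_mset] image_mset_cong) auto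
  also have "\<dots> = of_real (c * \<sigma>) * (\<Sum>\<^sub># (eigvals_mset A) - of_nat (size (eigvals_mset A)) * of_real r)
      + of_nat (size (eigvals_mset A)) * of_real d"
    by (rule sum_mset_affine)
  \<comment> \<open>The eigenvalues sum to the trace \<open>N r\<close>, so the linear part vanishes
    and only the constant \<open>d\<close> contributes, once for each eigenvalue.\<close>
  also have "\<dots> = complex_of_real (real N * d)"
    by (simp add: sum_eigvals[OF A] diag)
  finally have "energy_about r A = real N * d" by (simp only: of_real_eq_iff)
  then show ?thesis by (simp add: d_def field_simps)
qed

section \<open>Disjoint unions of equal complete graphs\<close>

text \<open>Two vertices of one clique have its remaining \<open>n - 2\<close> vertices as common
  neighbours, and vertices of different cliques have none. Hence every row of \<open>CN\<close> sums
  to \<open>r = (n - 1) s\<close>, which is also the mean.\<close>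

lemma equal_cliques_not_hyperenergetic:
  fixes \<G> :: "'v pair_pre_digraph" and f :: "'v \<Rightarrow> 'c"
  assumes fin: "finite (pverts \<G>)"
    and arcs: "\<And>u v. u \<in> pverts \<G> \<Longrightarrow> v \<in> pverts \<G> \<Longrightarrow>
      (u, v) \<in> parcs \<G> \<longleftrightarrow> u \<noteq> v \<and> f u = f v"
    and cl: "\<And>u. u \<in> pverts \<G> \<Longrightarrow> card {v \<in> pverts \<G>. f v = f u} = n"
    and n: "n > 0"
  shows "\<not> CNL_hyperenergetic \<G>" and "\<not> CNSL_hyperenergetic \<G>"
proof -
  define vs where "vs = vertex_enum \<G>"
  define N where "N = length vs"
  define g where "g i = f (vs ! i)" for i
  \<comment> \<open>The subtraction is truncated: for \<open>n = 1\<close> no clique contains two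
    vertices, and \<open>s = 0\<close> keeps the nonnegativity that \<open>clique_energy\<close>
    requires.\<close>
  define s where "s = real (n - 2)"
  define r where "r = (real n - 1) * s"
  have vs: "distinct vs" "set vs = pverts \<G>" using vertex_enum[OF fin] by (simp_all add: vs_def)
  have N: "card (pverts \<G>) = N" using vs distinct_card by (fastforce simp: N_def)
  have inV: "vs ! i \<in> pverts \<G>" if "i < N" for i using that vs(2) nth_mem by (auto simp: N_def)
  have gcl: "card {j \<in> {..<N}. g j = g i} = n" if i: "i < N" for i
  proof -
    have "bij_betw (\<lambda>j. vs ! j) {j \<in> {..<N}. g j = g i} {v \<in> pverts \<G>. f v = f (vs ! i)}"
      unfolding bij_betw_def
    proof
      show "inj_on ((!) vs) {j \<in> {..<N}. g j = g i}"
        using vs(1) by (auto simp: inj_on_def N_def nth_eq_iff_index_eq)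
      show "(!) vs ` {j \<in> {..<N}. g j = g i} = {v \<in> pverts \<G>. f v = f (vs ! i)}"
        unfolding vs(2)[symmetric] g_def N_def by (auto simp: in_set_conv_nth)
    qed
    then show ?thesis using cl[OF inV[OF i]] by (simp add: bij_betw_same_card)
  qed
  have cn: "real (card (common_nbrs \<G> u v)) = (if f v = f u then s else 0)"
    if uv: "u \<in> pverts \<G>" "v \<in> pverts \<G>" "u \<noteq> v" for u v
  proof (cases "f v = f u")
    case True
    have "common_nbrs \<G> u v = {w \<in> pverts \<G>. f w = f u} - {u, v}"
      using uv True arcs by (auto simp: common_nbrs_def)
    also have "card \<dots> = n - 2"
      using uv True fin cl[OF uv(1)] by (subst card_Diff_subset) auto
    finally show ?thesis using True by (simp add: s_def)
  next
    case False
    then have "common_nbrs \<G> u v = {}" using uv arcs by (auto simp: common_nbrs_def)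
    then show ?thesis using False by simp
  qed
  have CN: "CN \<G> vs $$ (i, j) = (if i = j then 0 else if g j = g i then s else 0)"
    if "i < N" "j < N" for i j
    using that cn inV vs(1) by (simp add: CN_def N_def g_def nth_eq_iff_index_eq)
  have row: "(\<Sum>j<N. CN \<G> vs $$ (i, j)) = r" if i: "i < N" for i
  proof -
    have "(\<Sum>j<N. CN \<G> vs $$ (i, j)) =
        (\<Sum>j<N. (if g j = g i then s else 0) - (if j = i then s else 0))"
      by (rule sum.cong) (auto simp: CN i)
    also have "\<dots> = (\<Sum>j<N. if g j = g i then s else 0) - s" using i by (simp add: sum_subtractf)
    also have "(\<Sum>j<N. if g j = g i then s else 0) = (\<Sum>j\<in>{j \<in> {..<N}. g j = g i}. s)"
      by (rule sum.mono_neutral_cong_right) auto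
    also have "\<dots> = real n * s" using gcl[OF i] by simp
    finally show ?thesis by (simp add: r_def algebra_simps)
  qed
  have RS: "CNRS \<G> vs = mat_diag N (\<lambda>i. r)"
    using row by (intro eq_matI) (auto simp: CNRS_def mat_diag_def N_def[symmetric])
  have dim: "CN \<G> vs \<in> carrier_mat N N" by (simp add: CN_def N_def)
  \<comment> \<open>\<open>CNL\<close> is \<open>r I - CN\<close> and \<open>CNSL\<close> is
    \<open>r I + CN\<close>. They differ only in the sign \<open>\<sigma>\<close>, on which the
    energy does not depend.\<close>
  have E: "energy_about r (CNL \<G> vs) = 2 * real N * s * (real n - 1) / real n"
    by (rule clique_energy[OF _ _ gcl n, where \<sigma> = "-1"])
      (use dim in \<open>auto simp: CNL_def RS mat_diag_def CN s_def\<close>)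
  have E': "energy_about r (CNSL \<G> vs) = 2 * real N * s * (real n - 1) / real n"
    by (rule clique_energy[OF _ _ gcl n, where \<sigma> = "1"])
      (use dim in \<open>auto simp: CNSL_def RS mat_diag_def CN s_def\<close>)
  have bound: "2 * real N * s * (real n - 1) / real n \<le> 2 * (real N - 1) * (real N - 2)"
    and mean: "N > 0 \<Longrightarrow> CN_mean \<G> vs = r"
  proof -
    show "N > 0 \<Longrightarrow> CN_mean \<G> vs = r"
      by (simp add: CN_mean_def RS diag_mat_def mat_diag_def interv_sum_list_conv_sum_set_nat
          N_def[symmetric])
    \<comment> \<open>No integer lies strictly between the roots 1 and 2.\<close>
    have pos: "0 \<le> (real N - 1) * (real N - 2)"
    proof -
      consider "N = 0" | "N = 1" | "N \<ge> 2" by linarith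
      then show ?thesis by cases auto
    qed
    show "2 * real N * s * (real n - 1) / real n \<le> 2 * (real N - 1) * (real N - 2)"
    proof (cases "N = 0 \<or> n < 2")
      case True
      then have "N = 0 \<or> s = 0" by (auto simp: s_def)
      then have "2 * real N * s * (real n - 1) / real n = 0" by auto
      then show ?thesis using pos by (simp only: mult.assoc)
    next
      case False
      have "n \<le> card (pverts \<G>)"
        using False cl[OF inV[of 0]] fin by (metis (no_types, lifting) card_mono gr0I mem_Collect_eq subsetI)
      then have nN: "n \<le> N" by (simp add: N)
      \<comment> \<open>After expansion this is \<open>n \<le> N\<close>. Multiplied by
        \<open>n - 2 \<le> N - 2\<close>, it gives the bound with denominators cleared.\<close>
      have "real N * (real n - 1) \<le> real n * (real N - 1)" using nN by (simp add: algebra_simps)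
      moreover have "s \<le> real N - 2" using nN False by (simp add: s_def)
      moreover have "0 \<le> real n * (real N - 1)" "0 \<le> s" using False by (auto simp: s_def)
      ultimately have "(real N * (real n - 1)) * s \<le> (real n * (real N - 1)) * (real N - 2)"
        by (rule mult_mono[of _ _ s "real N - 2"])
      then show ?thesis using n by (simp add: field_simps)
    qed
  qed
  \<comment> \<open>Without vertices the mean is a division by zero and need not equal
    \<open>r\<close>, but the energy is then an empty sum about any center.\<close>
  have nil: "energy_about t B = 0" if "N = 0" "B \<in> carrier_mat N N" for t B
    using sum_eigvals(2)[OF that(2)] that(1) by (simp add: energy_about_def)
  have dims: "CNL \<G> vs \<in> carrier_mat N N" "CNSL \<G> vs \<in> carrier_mat N N"
    using dim by (auto simp: CNL_def CNSL_def RS)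
  have "LE_CN \<G> = 2 * real N * s * (real n - 1) / real n"
    using E mean nil[OF _ dims(1)] by (cases "N = 0") (simp_all add: LE_CN_def Let_def vs_def)
  then show "\<not> CNL_hyperenergetic \<G>" using bound by (simp add: CNL_hyperenergetic_def N)
  have "LE_CN_plus \<G> = 2 * real N * s * (real n - 1) / real n"
    using E' mean nil[OF _ dims(2)] by (cases "N = 0") (simp_all add: LE_CN_plus_def Let_def vs_def)
  then show "\<not> CNSL_hyperenergetic \<G>" using bound by (simp add: CNSL_hyperenergetic_def N)
qed

section \<open>Centralizers of noncentral elements\<close>

definition centralizer :: "('a, 'b) monoid_scheme \<Rightarrow> 'a \<Rightarrow> 'a set" where
  "centralizer G x = {g \<in> carrier G. g \<otimes>\<^bsub>G\<^esub> x = x \<otimes>\<^bsub>G\<^esub> g}"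

text \<open>This makes the library results on group actions available: centralizers are subgroups,
  and orbit-stabilizer counts conjugacy classes.\<close>

lemma (in group) centralizer_eq_stabilizer:
  assumes x: "x \<in> carrier G"
  shows "centralizer G x = stabilizer G (\<lambda>g. \<lambda>h \<in> carrier G. g \<otimes> h \<otimes> inv g) x"
proof -
  have "g \<otimes> x \<otimes> inv g = x \<longleftrightarrow> g \<otimes> x = x \<otimes> g" if "g \<in> carrier G" for g
    using that x by (metis inv_solve_right m_closed)
  then show ?thesis using x by (auto simp: centralizer_def stabilizer_def)
qed

text \<open>The isomorphism type of the quotient enters as its order and its commutativity, both
  expressed by elements of \<open>G\<close>, so that no cosets appear in the arguments
  below.\<close>

locale central_quotient_order_p2 = group G for G (structure) +
  fixes p :: nat
  assumes finite_carrier: "finite (carrier G)"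
    and prime_p: "prime p"
    and order_eq: "Coset.order G = p\<^sup>2 * card (center G)"
    and commute_mod_center: "\<And>x y. x \<in> carrier G \<Longrightarrow> y \<in> carrier G \<Longrightarrow>
      \<exists>z \<in> center G. x \<otimes> y = z \<otimes> (y \<otimes> x)"
begin

lemma center_subgroup: "subgroup (center G) G"
  using center_normal by (rule normal_imp_subgroup)

lemma card_center_pos: "card (center G) > 0"
  using subgroup.finite_imp_card_positive[OF center_subgroup finite_carrier] .

text \<open>Lagrange twice: the index of the center in \<open>H\<close> divides \<open>p^2\<close>,
  hence is 1, \<open>p\<close> or \<open>p^2\<close>, and the two strict inclusions exclude the
  extremes.\<close>

lemma card_intermediate_subgroup:
  assumes H: "subgroup H G" and "center G \<subset> H" and ne: "H \<noteq> carrier G"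
  shows "card H = p * card (center G)"
proof -
  let ?z = "card (center G)"
  have finH: "finite H" using H finite_carrier by (meson finite_subset subgroup.subset)
  have "subgroup (center G) (G\<lparr>carrier := H\<rparr>)"
    using assms center_subgroup subgroup_incl by blast
  from group.lagrange[OF subgroup.subgroup_is_group[OF H is_group] this]
  obtain a where a: "card H = a * ?z" by (simp add: Coset.order_def) (metis that)
  obtain b where b: "b * card H = Coset.order G"
    by (rule that[OF lagrange[OF H]])
  have ab: "b * a = p\<^sup>2" using b a order_eq card_center_pos by simp
  then have "a dvd p\<^sup>2" by (metis dvd_triv_right)
  then obtain k where k: "k \<le> 2" "a = p ^ k"
    using divides_primepow_nat[OF prime_p] by blast
  have "a \<noteq> 1"
    using a assms(2) card_subset_eq[OF finH, of "center G"] by auto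
  moreover have "k \<noteq> 2"
  proof
    assume "k = 2"
    then have "card H = card (carrier G)" using k a order_eq by (simp add: Coset.order_def)
    then show False
      using ne card_subset_eq[OF finite_carrier subgroup.subset[OF H]] by simp
  qed
  ultimately have "k = 1" using k by (cases "k = 0") auto
  then show ?thesis using a k by simp
qed

lemma centralizer_subgroup: "x \<in> carrier G \<Longrightarrow> subgroup (centralizer G x) G"
  using group_action.stabilizer_subgroup[OF action_by_conjugation]
  by (simp add: centralizer_eq_stabilizer)

lemma centralizer_noncentral:
  assumes x: "x \<in> carrier G - center G"
  shows "center G \<subset> centralizer G x" and "centralizer G x \<noteq> carrier G"
    and "card (centralizer G x) = p * card (center G)"
proof -
  have "x \<in> centralizer G x" using x by (simp add: centralizer_def)
  then show 1: "center G \<subset> centralizer G x" using x by (auto simp: centralizer_def center_def)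
  show 2: "centralizer G x \<noteq> carrier G"
  proof
    assume "centralizer G x = carrier G"
    then have "x \<otimes> g = g \<otimes> x" if "g \<in> carrier G" for g
      using that unfolding centralizer_def by (metis (mono_tags, lifting) mem_Collect_eq)
    then show False using x by (simp add: center_def)
  qed
  show "card (centralizer G x) = p * card (center G)"
    using card_intermediate_subgroup[OF centralizer_subgroup 1 2] x by simp
qed

text \<open>If \<open>x\<close> and \<open>y\<close> commute, the intersection \<open>?D\<close> of
  their centralizers contains the center and also the noncentral \<open>x\<close>. It is therefore a
  proper intermediate subgroup with as many elements as each centralizer, so both equal
  \<open>?D\<close>.\<close>

lemma centralizer_eq_iff_commute:
  assumes x: "x \<in> carrier G - center G" and y: "y \<in> carrier G - center G"
  shows "centralizer G x = centralizer G y \<longleftrightarrow> x \<otimes> y = y \<otimes> x"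
proof
  assume "centralizer G x = centralizer G y"
  moreover have "x \<in> centralizer G x" using x by (simp add: centralizer_def)
  ultimately show "x \<otimes> y = y \<otimes> x" by (simp add: centralizer_def)
next
  assume comm: "x \<otimes> y = y \<otimes> x"
  let ?D = "centralizer G x \<inter> centralizer G y"
  note cx = centralizer_noncentral[OF x] and cy = centralizer_noncentral[OF y]
  have sub: "subgroup ?D G"
    using x y by (intro subgroups_Inter_pair centralizer_subgroup) auto
  have "x \<in> ?D" using x comm by (simp add: centralizer_def)
  then have "center G \<subset> ?D" using cx(1) cy(1) x by blast
  moreover have "?D \<noteq> carrier G"
    using cx(2) subgroup.subset[OF centralizer_subgroup] x by blast
  ultimately have cD: "card ?D = p * card (center G)" by (intro card_intermediate_subgroup sub)
  have "finite (centralizer G a)" for a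
    using finite_carrier by (simp add: centralizer_def)
  then show "centralizer G x = centralizer G y"
    using cD cx(3) cy(3) by (metis card_subset_eq inf_le1 inf_le2)
qed

section \<open>Noncentral conjugacy classes\<close>

lemma conj_class_in_center_coset:
  assumes x: "x \<in> carrier G" and y: "y \<in> conj_class G x"
  obtains z where "z \<in> center G" "y = z \<otimes> x"
proof -
  obtain g where g: "g \<in> carrier G" "y = g \<otimes> x \<otimes> inv g"
    using x y by (auto simp: conj_class_def orbit_def)
  obtain z where z: "z \<in> center G" "g \<otimes> x = z \<otimes> (x \<otimes> g)"
    using commute_mod_center g x by blast
  have "z \<in> carrier G" using z by (simp add: center_def)
  then have "y = z \<otimes> x" using g x z by (simp add: m_assoc)
  then show ?thesis using that z by blast
qed

text \<open>Write \<open>y = z x\<close> with \<open>z\<close> central. Were \<open>y\<close>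
  central, so would be \<open>x = inv z y\<close>; and \<open>y\<close> commutes with
  \<open>x\<close>, which forces equal centralizers.\<close>

lemma conj_class_noncentral:
  assumes x: "x \<in> carrier G - center G" and y: "y \<in> conj_class G x"
  shows "y \<in> carrier G - center G" and "centralizer G y = centralizer G x"
proof -
  obtain z where z: "z \<in> center G" "y = z \<otimes> x" using conj_class_in_center_coset x y by blast
  have zc: "z \<in> carrier G" using z by (simp add: center_def)
  have "x = inv z \<otimes> y" using z(2) zc x by (simp add: m_assoc[symmetric])
  then show y': "y \<in> carrier G - center G"
    using z zc x subgroup.m_closed[OF center_subgroup]
      subgroup.m_inv_closed[OF center_subgroup] by (metis DiffE DiffI m_closed)
  have "y \<otimes> x = x \<otimes> y"
    using z zc x by (simp add: center_def m_assoc)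
  then show "centralizer G y = centralizer G x" using centralizer_eq_iff_commute[OF y' x] by simp
qed

lemma conj_class_refl: "x \<in> carrier G \<Longrightarrow> x \<in> conj_class G x"
  unfolding conj_class_def by (rule group_action.orbit_refl[OF action_by_conjugation])

lemma conj_class_disjoint:
  assumes "x \<in> carrier G" "y \<in> carrier G" "conj_class G x \<noteq> conj_class G y"
  shows "conj_class G x \<inter> conj_class G y = {}"
  using group_action.disjoint_union[OF action_by_conjugation, of "conj_class G x" "conj_class G y"]
    assms by (auto simp: orbits_def conj_class_def)

text \<open>By orbit-stabilizer the class has \<open>p^2 |Z| / (p |Z|)\<close> elements, where
  \<open>Z\<close> is the center.\<close>

lemma card_conj_class:
  assumes x: "x \<in> carrier G - center G"
  shows "card (conj_class G x) = p"
proof -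
  have "card (conj_class G x) * card (centralizer G x) = Coset.order G"
    using group_action.orbit_stabilizer_theorem[OF action_by_conjugation, of x] x
    by (simp add: conj_class_def centralizer_eq_stabilizer)
  then show ?thesis
    using order_eq centralizer_noncentral(3)[OF x] card_center_pos prime_gt_0_nat[OF prime_p]
    by (simp add: power2_eq_square)
qed

section \<open>Clique structure of the graph\<close>

text \<open>The cliques of the graph are the fibres of \<open>clique_label\<close>.\<close>

definition clique_label :: "'a set \<Rightarrow> 'a set" where
  "clique_label A = (\<Inter>a\<in>A. centralizer G a)"

text \<open>All centralizers in the intersection coincide, so the label is their common value and no
  representative has to be chosen.\<close>

lemma clique_label_conj_class:
  assumes x: "x \<in> carrier G - center G"
  shows "clique_label (conj_class G x) = centralizer G x"
proof -
  have "clique_label (conj_class G x) = (\<Inter>a\<in>conj_class G x. centralizer G x)"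
    unfolding clique_label_def by (rule INF_cong[OF refl conj_class_noncentral(2)[OF x]])
  also have "\<dots> = centralizer G x"
    using conj_class_refl[of x] x by (intro INF_const) blast
  finally show ?thesis .
qed

lemma pverts_CCC_graph: "pverts (CCC_graph G) = conj_class G ` (carrier G - center G)"
  by (auto simp: CCC_graph_def Let_def)

text \<open>Commuting members of two classes share their centralizers with \<open>x\<close> and
  \<open>y\<close>. Conversely, equal centralizers make \<open>x\<close> and \<open>y\<close>
  themselves commute.\<close>

lemma CCC_graph_arc_iff:
  assumes "A \<in> pverts (CCC_graph G)" "B \<in> pverts (CCC_graph G)"
  shows "(A, B) \<in> parcs (CCC_graph G) \<longleftrightarrow> A \<noteq> B \<and> clique_label A = clique_label B"
proof -
  obtain x y where x: "x \<in> carrier G - center G" "A = conj_class G x"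
    and y: "y \<in> carrier G - center G" "B = conj_class G y"
    using assms by (auto simp: pverts_CCC_graph)
  have "(\<exists>x' \<in> A. \<exists>y' \<in> B. x' \<otimes> y' = y' \<otimes> x') \<longleftrightarrow> centralizer G x = centralizer G y"
  proof
    assume "\<exists>x' \<in> A. \<exists>y' \<in> B. x' \<otimes> y' = y' \<otimes> x'"
    then obtain x' y' where "x' \<in> A" "y' \<in> B" "x' \<otimes> y' = y' \<otimes> x'" by blast
    then show "centralizer G x = centralizer G y"
      using x y conj_class_noncentral centralizer_eq_iff_commute by metis
  next
    assume "centralizer G x = centralizer G y"
    then have "x \<otimes> y = y \<otimes> x" using x y centralizer_eq_iff_commute by blast
    then show "\<exists>x' \<in> A. \<exists>y' \<in> B. x' \<otimes> y' = y' \<otimes> x'" using x y conj_class_refl by blast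
  qed
  then show ?thesis
    using assms clique_label_conj_class x y by (simp add: CCC_graph_def Let_def)
qed

text \<open>The classes labelled by the centralizer of \<open>x\<close> partition its noncentral
  elements into sets of size \<open>p\<close>; both sides count these elements.\<close>

lemma card_clique:
  assumes "A \<in> pverts (CCC_graph G)"
  shows "p * card {B \<in> pverts (CCC_graph G). clique_label B = clique_label A} =
    p * card (center G) - card (center G)"
proof -
  obtain x where x: "x \<in> carrier G - center G" "A = conj_class G x"
    using assms by (auto simp: pverts_CCC_graph)
  let ?F = "{B \<in> pverts (CCC_graph G). clique_label B = clique_label A}"
  have F: "?F = conj_class G ` (centralizer G x - center G)"
  proof (intro equalityI subsetI)
    fix B assume "B \<in> ?F"
    then obtain y where y: "y \<in> carrier G - center G" "B = conj_class G y"
      and eq: "clique_label B = clique_label A"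
      unfolding pverts_CCC_graph by blast
    then have "centralizer G y = centralizer G x" using x clique_label_conj_class by simp
    moreover have "y \<in> centralizer G y" using y by (simp add: centralizer_def)
    ultimately show "B \<in> conj_class G ` (centralizer G x - center G)" using y by auto
  next
    fix B assume "B \<in> conj_class G ` (centralizer G x - center G)"
    then obtain y where y: "y \<in> centralizer G x" "y \<notin> center G" "B = conj_class G y" by blast
    then have y': "y \<in> carrier G - center G" and "y \<otimes> x = x \<otimes> y" by (auto simp: centralizer_def)
    then have "centralizer G y = centralizer G x" using centralizer_eq_iff_commute x by blast
    then show "B \<in> ?F"
      using y y' x clique_label_conj_class by (auto simp: pverts_CCC_graph)
  qed
  have U: "\<Union>?F = centralizer G x - center G"
  proof (intro equalityI subsetI)
    fix b assume "b \<in> \<Union>?F"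
    then obtain y where y: "y \<in> centralizer G x" "y \<notin> center G" "b \<in> conj_class G y"
      unfolding F by blast
    then have y': "y \<in> carrier G - center G" and "y \<otimes> x = x \<otimes> y" by (auto simp: centralizer_def)
    then have "centralizer G y = centralizer G x" using centralizer_eq_iff_commute x by blast
    moreover have "b \<in> centralizer G b"
      using conj_class_noncentral(1)[OF y' y(3)] by (simp add: centralizer_def)
    ultimately show "b \<in> centralizer G x - center G"
      using conj_class_noncentral[OF y' y(3)] by simp
  next
    fix b assume "b \<in> centralizer G x - center G"
    then show "b \<in> \<Union>?F"
      unfolding F using conj_class_refl by (auto simp: centralizer_def)
  qed
  have "p * card ?F = card (\<Union>?F)"
  proof (rule card_partition)
    show "finite (\<Union>?F)" unfolding U using finite_carrier by (simp add: centralizer_def)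
    show "finite ?F" unfolding F using finite_carrier by (simp add: centralizer_def)
    show "card B = p" if "B \<in> ?F" for B
      using that card_conj_class by (auto simp: pverts_CCC_graph)
    show "B \<inter> C = {}" if "B \<in> ?F" "C \<in> ?F" "B \<noteq> C" for B C
      using that conj_class_disjoint by (auto simp: pverts_CCC_graph)
  qed
  also have "\<dots> = p * card (center G) - card (center G)"
    unfolding U using centralizer_noncentral[OF x(1)] finite_carrier
    by (subst card_Diff_subset) (auto simp: center_def)
  finally show ?thesis .
qed

theorem CCC_graph_not_hyperenergetic:
  "\<not> CNL_hyperenergetic (CCC_graph G)" "\<not> CNSL_hyperenergetic (CCC_graph G)"
proof -
  let ?V = "pverts (CCC_graph G)"
  \<comment> \<open>The division is exact by \<open>card_clique\<close>. For an empty vertex set the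
    value 1 keeps \<open>n\<close> positive, and the condition on clique sizes is vacuous.\<close>
  define n where "n = (if ?V = {} then 1 else (p * card (center G) - card (center G)) div p)"
  have p: "p > 1" using prime_gt_1_nat[OF prime_p] .
  have fin: "finite ?V" using finite_carrier by (simp add: pverts_CCC_graph)
  have cl: "card {B \<in> ?V. clique_label B = clique_label A} = n" if "A \<in> ?V" for A
  proof -
    have "n = (p * card {B \<in> ?V. clique_label B = clique_label A}) div p"
      using that card_clique[OF that] by (auto simp: n_def)
    then show ?thesis using p by simp
  qed
  have n: "n > 0"
  proof (cases "?V = {}")
    case False
    then obtain A where A: "A \<in> ?V" by blast
    then have "{B \<in> ?V. clique_label B = clique_label A} \<noteq> {}" by blast
    moreover have "finite {B \<in> ?V. clique_label B = clique_label A}" using fin by simp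
    ultimately show ?thesis using cl[OF A] by (metis card_gt_0_iff)
  qed (simp add: n_def)
  show "\<not> CNL_hyperenergetic (CCC_graph G)" "\<not> CNSL_hyperenergetic (CCC_graph G)"
    using equal_cliques_not_hyperenergetic[OF fin CCC_graph_arc_iff cl n] by blast+
qed

end

section \<open>From the quotient isomorphism to orders and commutators\<close>

theorem theorem3p2:
  fixes G :: "('a, 'b) monoid_scheme" and p :: nat
  assumes "group G"
    and "finite (carrier G)"
    and "\<not> comm_group G"
    and "prime p"
    and "G Mod (center G) \<cong> integer_mod_group p \<times>\<times> integer_mod_group p"
  shows "\<not> CNL_hyperenergetic (CCC_graph G) \<and> \<not> CNSL_hyperenergetic (CCC_graph G)"
proof -
  interpret group G by fact
  interpret Z: normal "center G" G by (rule center_normal)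
  let ?Q = "G Mod (center G)" and ?P = "integer_mod_group p \<times>\<times> integer_mod_group p"
  have "card (carrier ?Q) = card (carrier ?P)" by (rule iso_same_card[OF assms(5)])
  also have "\<dots> = p\<^sup>2"
    using prime_gt_0_nat[OF assms(4)]
    by (simp add: DirProd_def carrier_integer_mod_group card_cartesian_product power2_eq_square)
  finally have ord: "Coset.order G = p\<^sup>2 * card (center G)"
    using lagrange[OF Z.subgroup_axioms] by (simp add: FactGroup_def)
  have comm: "a \<otimes>\<^bsub>?P\<^esub> b = b \<otimes>\<^bsub>?P\<^esub> a" for a b
    by (cases a; cases b) (simp add: DirProd_def add.commute)
  obtain h where h: "h \<in> iso ?Q ?P" using assms(5) by (auto simp: is_iso_def)
  then have hom: "h \<in> hom ?Q ?P" and inj: "inj_on h (carrier ?Q)"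
    by (auto simp: iso_def bij_betw_def)
  have "\<exists>z \<in> center G. x \<otimes>\<^bsub>G\<^esub> y = z \<otimes>\<^bsub>G\<^esub> (y \<otimes>\<^bsub>G\<^esub> x)" if x: "x \<in> carrier G" and y: "y \<in> carrier G" for x y
  proof -
    have Q: "center G #>\<^bsub>G\<^esub> x \<in> carrier ?Q" "center G #>\<^bsub>G\<^esub> y \<in> carrier ?Q"
      using x y by (auto simp: FactGroup_def RCOSETS_def)
    note cl = monoid.m_closed[OF group.is_monoid[OF Z.factorgroup_is_group]]
    \<comment> \<open>The product of cyclic groups is commutative, and injectivity of
      \<open>h\<close> pulls this back to the quotient.\<close>
    have "h ((center G #>\<^bsub>G\<^esub> x) \<otimes>\<^bsub>?Q\<^esub> (center G #>\<^bsub>G\<^esub> y)) = h ((center G #>\<^bsub>G\<^esub> y) \<otimes>\<^bsub>?Q\<^esub> (center G #>\<^bsub>G\<^esub> x))"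
      unfolding hom_mult[OF hom Q] hom_mult[OF hom Q(2,1)] by (rule comm)
    then have "(center G #>\<^bsub>G\<^esub> x) \<otimes>\<^bsub>?Q\<^esub> (center G #>\<^bsub>G\<^esub> y) = (center G #>\<^bsub>G\<^esub> y) \<otimes>\<^bsub>?Q\<^esub> (center G #>\<^bsub>G\<^esub> x)"
      by (rule inj_onD[OF inj _ cl[OF Q] cl[OF Q(2,1)]])
    then have "center G #>\<^bsub>G\<^esub> (x \<otimes>\<^bsub>G\<^esub> y) = center G #>\<^bsub>G\<^esub> (y \<otimes>\<^bsub>G\<^esub> x)"
      using x y by (simp add: FactGroup_def Z.rcos_sum)
    \<comment> \<open>As the two cosets agree, \<open>x y\<close> lies in the coset of
      \<open>y x\<close>, which provides the central factor \<open>z\<close>.\<close>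
    moreover have "x \<otimes>\<^bsub>G\<^esub> y \<in> center G #>\<^bsub>G\<^esub> (x \<otimes>\<^bsub>G\<^esub> y)"
      using x y by (intro rcos_self Z.subgroup_axioms) simp
    ultimately show ?thesis by (auto simp: r_coset_def)
  qed
  then interpret central_quotient_order_p2 G p
    using assms ord by unfold_locales auto
  show ?thesis using CCC_graph_not_hyperenergetic by blast
qed

end
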